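(* Let $(\Omega^\bullet,d)$ be a differential calculus on an algebra $A$, let $V$ be a vector space of derivations on $A$, closed under commutator, for which the interior products and Lie derivatives are well defined, and let $\omega\in\Omega^2$ be closed and nonsingular. If both $a\in A$ and $b\in A$ are Hamiltonian, then $$\{a,b\}=-\{b,a\},$$ i.e. the Poisson bracket is antisymmetric.
   Context: $A$ is an associative unital (not necessarily commutative) algebra over a field. A differential calculus on $A$ is a collection of $A$-bimodules $\Omega^n$, $n\ge 0$, with $\Omega^0=A$, with an associative graded product $\Omega^n\times\Omega^m\to\Omega^{n+m}$ extending the bimodule structure, and with a linear signed derivation $d:\Omega^n\to\Omega^{n+1}$, i.e. $d(\omega\tau)=d(\omega)\,\tau+(-1)^{|\omega|}\omega\,d(\tau)$ (where $|\omega|=n$ if $\omega\in\Omega^n$), such that $d^2=0$ and $\Omega^{n+1}$ is spanned by the elements $\omega\,db$ with $\omega\in\Omega^n$, $b\in A$. Everything is purely algebraic (no topology). $V$ is a vector space of linear maps $\theta:A\to A$ with $\theta(ab)=\theta(a)b+a\theta(b)$, closed under the commutator $[\theta,\phi]=\theta\phi-\phi\theta$. Interior product: for $\theta\in V$, $\theta\lrcorner:\Omega^{n+1}\to\Omega^n$ is the linear map determined by $\theta\lrcorner a=0$ for $a\in\Omega^0=A$, $\theta\lrcorner da=\theta(a)$, and $\theta\lrcorner(\omega\tau)=(\theta\lrcorner\,\omega)\tau+(-1)^{|\omega|}\omega(\theta\lrcorner\tau)$. Lie derivative: for $\theta\in V$, ${\cal L}_\theta:\Omega^n\to\Omega^n$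 is the linear map determined by ${\cal L}_\theta(a)=\theta(a)$ for $a\in\Omega^0=A$, ${\cal L}_\theta(da)=d(\theta(a))$, and ${\cal L}_\theta(\omega\tau)={\cal L}_\theta(\omega)\tau+\omega{\cal L}_\theta(\tau)$. Standing assumption: for every $\theta\in V$ the maps $\theta\lrcorner$ and ${\cal L}_\theta$ are well defined on all of $\Omega^\bullet$ (i.e. compatible with all relations in the calculus). Fix $\omega\in\Omega^2$ with $d\omega=0$ (closed). Let $V^\omega=\{\theta\in V:{\cal L}_\theta(\omega)=0\}$, let $Z^1=\{\eta\in\Omega^1: d\eta=0\}$, and define $\tilde\omega:V^\omega\to Z^1$ by $\tilde\omega(\theta)=\theta\lrcorner\,\omega$ (for $\theta\in V$ one has ${\cal L}_\theta(\omega)=0$ if and only if $d(\theta\lrcorner\,\omega)=0$). The form $\omega$ is nonsingular if $\tilde\omega$ is injective. An element $a\in A$ is Hamiltonian if $da$ is in the image of $\tilde\omega$; then $X_a\in V^\omega$ denotes the unique element with $\tilde\omega(X_a)=da$. For Hamiltonian $a,b$ the Poisson bracket is $\{a,b\}=X_a\lrcorner(db)=X_a(b)\in A$. *)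

theory Defs
  imports Complex_Main
begin

text \<open>
  The sort \<open>{ring, monoid_mult}\<close> is used instead of \<open>ring_1\<close> because the latter excludes
  the zero algebra.
\<close>

locale assoc_algebra = vector_space scale
  for scale :: "'k::field \<Rightarrow> 'a::{ring, monoid_mult} \<Rightarrow> 'a" +
  assumes scale_mult_left: "scale c (x * y) = scale c x * y"
    and scale_mult_right: "scale c (x * y) = x * scale c y"

text \<open>
  The spaces of forms are the homogeneous components \<open>\<Omega> n\<close> of one graded algebra, the direct
  sum of all of them, which is the type \<open>'w\<close>. The algebra of functions is the type \<open>'a\<close>,
  identified with \<open>\<Omega> 0\<close> by the injective unital homomorphism \<open>\<iota>\<close>; the bimodule structure
  of \<open>\<Omega> n\<close> is multiplication by \<open>\<iota> a\<close> on either side.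
\<close>

locale differential_calculus =
  A: assoc_algebra scaleA + W: assoc_algebra scaleW
  for scaleA :: "'k::field \<Rightarrow> 'a::{ring, monoid_mult} \<Rightarrow> 'a"
    and scaleW :: "'k \<Rightarrow> 'w::{ring, monoid_mult} \<Rightarrow> 'w" +
  fixes \<iota> :: "'a \<Rightarrow> 'w"
    and \<Omega> :: "nat \<Rightarrow> 'w set"
    and d :: "'w \<Rightarrow> 'w"
  assumes subspace_forms: "W.subspace (\<Omega> n)"
    and direct_sum: "\<exists>!f. (\<forall>n. f n \<in> \<Omega> n) \<and> finite {n. f n \<noteq> 0} \<and> w = (\<Sum>n | f n \<noteq> 0. f n)"
    and mult_forms: "u \<in> \<Omega> n \<Longrightarrow> v \<in> \<Omega> m \<Longrightarrow> u * v \<in> \<Omega> (n + m)"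
    and linear_\<iota>: "Vector_Spaces.linear scaleA scaleW \<iota>"
    and \<iota>_mult: "\<iota> (x * y) = \<iota> x * \<iota> y"
    and \<iota>_one: "\<iota> 1 = 1"
    and inj_\<iota>: "inj \<iota>"
    and range_\<iota>: "range \<iota> = \<Omega> 0"
    and linear_d: "Vector_Spaces.linear scaleW scaleW d"
    and d_forms: "u \<in> \<Omega> n \<Longrightarrow> d u \<in> \<Omega> (Suc n)"
    and d_mult: "u \<in> \<Omega> n \<Longrightarrow> v \<in> \<Omega> m \<Longrightarrow> d (u * v) = d u * v + scaleW ((-1) ^ n) (u * d v)"
    and d_d: "d (d u) = 0"
    and span_forms: "\<Omega> (Suc n) = W.span {u * d (\<iota> b) | u b. u \<in> \<Omega> n}"
begin

definition derivation :: "('a \<Rightarrow> 'a) \<Rightarrow> bool" where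
  "derivation \<theta> \<longleftrightarrow>
     Vector_Spaces.linear scaleA scaleA \<theta> \<and> (\<forall>a b. \<theta> (a * b) = \<theta> a * b + a * \<theta> b)"

definition is_interior_product :: "('a \<Rightarrow> 'a) \<Rightarrow> ('w \<Rightarrow> 'w) \<Rightarrow> bool" where
  "is_interior_product \<theta> i \<longleftrightarrow>
     Vector_Spaces.linear scaleW scaleW i \<and>
     (\<forall>n. i ` \<Omega> (Suc n) \<subseteq> \<Omega> n) \<and>
     (\<forall>a. i (\<iota> a) = 0) \<and>
     (\<forall>a. i (d (\<iota> a)) = \<iota> (\<theta> a)) \<and>
     (\<forall>n m. \<forall>u \<in> \<Omega> n. \<forall>v \<in> \<Omega> m. i (u * v) = i u * v + scaleW ((-1) ^ n) (u * i v))"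

definition is_lie_derivative :: "('a \<Rightarrow> 'a) \<Rightarrow> ('w \<Rightarrow> 'w) \<Rightarrow> bool" where
  "is_lie_derivative \<theta> L \<longleftrightarrow>
     Vector_Spaces.linear scaleW scaleW L \<and>
     (\<forall>n. L ` \<Omega> n \<subseteq> \<Omega> n) \<and>
     (\<forall>a. L (\<iota> a) = \<iota> (\<theta> a)) \<and>
     (\<forall>a. L (d (\<iota> a)) = d (\<iota> (\<theta> a))) \<and>
     (\<forall>n m. \<forall>u \<in> \<Omega> n. \<forall>v \<in> \<Omega> m. L (u * v) = L u * v + u * L v)"

definition interior :: "('a \<Rightarrow> 'a) \<Rightarrow> 'w \<Rightarrow> 'w" where
  "interior \<theta> = (THE i. is_interior_product \<theta> i)"

definition lie :: "('a \<Rightarrow> 'a) \<Rightarrow> 'w \<Rightarrow> 'w" where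
  "lie \<theta> = (THE L. is_lie_derivative \<theta> L)"

text \<open>
  Maps satisfying these conditions are unique, so \<open>interior\<close> and \<open>lie\<close> are the intended maps
  as soon as such maps exist.
\<close>

lemma linear_eqI:
  assumes f: "Vector_Spaces.linear scaleW scaleW f" and g: "Vector_Spaces.linear scaleW scaleW g"
    and zero: "\<And>a. f (\<iota> a) = g (\<iota> a)"
    and step: "\<And>n u b. u \<in> \<Omega> n \<Longrightarrow> f u = g u \<Longrightarrow> f (u * d (\<iota> b)) = g (u * d (\<iota> b))"
  shows "f = g"
proof
  interpret f: Vector_Spaces.linear scaleW scaleW f by (rule f)
  interpret g: Vector_Spaces.linear scaleW scaleW g by (rule g)
  interpret VW: vector_space_pair scaleW scaleW ..
  have forms: "u \<in> \<Omega> n \<Longrightarrow> f u = g u" for n u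
  proof (induction n arbitrary: u)
    case 0
    then show ?case using zero by (auto simp flip: range_\<iota>)
  next
    case (Suc n)
    have "u \<in> W.span {u * d (\<iota> b) | u b. u \<in> \<Omega> n}"
      using Suc.prems span_forms by blast
    then show ?case
      by (rule VW.linear_eq_on[OF f g]) (use Suc.IH step in blast)
  qed
  fix w
  obtain h where h: "\<forall>n. h n \<in> \<Omega> n" "w = (\<Sum>n | h n \<noteq> 0. h n)"
    using direct_sum[of w] by blast
  then show "f w = g w"
    by (auto simp: f.sum g.sum intro!: sum.cong forms)
qed

lemma d_\<iota>_form: "d (\<iota> b) \<in> \<Omega> 1"
  using d_forms[of "\<iota> b" 0] range_\<iota> by auto

lemma is_interior_product_unique:
  assumes "is_interior_product \<theta> i" and "is_interior_product \<theta> j"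
  shows "i = j"
proof (rule linear_eqI)
  show "i (u * d (\<iota> b)) = j (u * d (\<iota> b))" if "u \<in> \<Omega> n" "i u = j u" for n u b
  proof -
    have "k (u * d (\<iota> b)) = k u * d (\<iota> b) + scaleW ((-1) ^ n) (u * \<iota> (\<theta> b))"
      if "is_interior_product \<theta> k" for k
      using that \<open>u \<in> \<Omega> n\<close> d_\<iota>_form[of b] by (simp add: is_interior_product_def)
    from this[OF assms(1)] this[OF assms(2)] show ?thesis
      using \<open>i u = j u\<close> by simp
  qed
qed (use assms in \<open>auto simp: is_interior_product_def\<close>)

lemma is_lie_derivative_unique:
  assumes "is_lie_derivative \<theta> L" and "is_lie_derivative \<theta> M"
  shows "L = M"
proof (rule linear_eqI)
  show "L (u * d (\<iota> b)) = M (u * d (\<iota> b))" if "u \<in> \<Omega> n" "L u = M u" for n u b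
  proof -
    have "k (u * d (\<iota> b)) = k u * d (\<iota> b) + u * d (\<iota> (\<theta> b))"
      if "is_lie_derivative \<theta> k" for k
      using that \<open>u \<in> \<Omega> n\<close> d_\<iota>_form[of b] by (simp add: is_lie_derivative_def)
    from this[OF assms(1)] this[OF assms(2)] show ?thesis
      using \<open>L u = M u\<close> by simp
  qed
qed (use assms in \<open>auto simp: is_lie_derivative_def\<close>)

end

locale calculus_with_derivations =
  differential_calculus scaleA scaleW \<iota> \<Omega> d
  for scaleA :: "'k::field \<Rightarrow> 'a::{ring, monoid_mult} \<Rightarrow> 'a"
    and scaleW :: "'k \<Rightarrow> 'w::{ring, monoid_mult} \<Rightarrow> 'w"
    and \<iota> :: "'a \<Rightarrow> 'w"
    and \<Omega> :: "nat \<Rightarrow> 'w set"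
    and d :: "'w \<Rightarrow> 'w" +
  fixes V :: "('a \<Rightarrow> 'a) set"
  assumes V_derivation: "\<theta> \<in> V \<Longrightarrow> derivation \<theta>"
    and V_zero: "(\<lambda>a. 0) \<in> V"
    and V_add: "\<theta> \<in> V \<Longrightarrow> \<phi> \<in> V \<Longrightarrow> (\<lambda>a. \<theta> a + \<phi> a) \<in> V"
    and V_scale: "\<theta> \<in> V \<Longrightarrow> (\<lambda>a. scaleA c (\<theta> a)) \<in> V"
    and V_commutator: "\<theta> \<in> V \<Longrightarrow> \<phi> \<in> V \<Longrightarrow> (\<lambda>a. \<theta> (\<phi> a) - \<phi> (\<theta> a)) \<in> V"
    and interior_exists: "\<theta> \<in> V \<Longrightarrow> \<exists>i. is_interior_product \<theta> i"
    and lie_exists: "\<theta> \<in> V \<Longrightarrow> \<exists>L. is_lie_derivative \<theta> L"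
begin

lemma interior_works: "\<theta> \<in> V \<Longrightarrow> is_interior_product \<theta> (interior \<theta>)"
  unfolding interior_def by (metis interior_exists is_interior_product_unique theI)

lemma lie_works: "\<theta> \<in> V \<Longrightarrow> is_lie_derivative \<theta> (lie \<theta>)"
  unfolding lie_def by (metis lie_exists is_lie_derivative_unique theI)

definition preserving :: "'w \<Rightarrow> ('a \<Rightarrow> 'a) set" where
  "preserving \<omega> = {\<theta> \<in> V. lie \<theta> \<omega> = 0}"

definition tilde :: "'w \<Rightarrow> ('a \<Rightarrow> 'a) \<Rightarrow> 'w" where
  "tilde \<omega> \<theta> = interior \<theta> \<omega>"

definition nonsingular :: "'w \<Rightarrow> bool" where
  "nonsingular \<omega> \<longleftrightarrow> inj_on (tilde \<omega>) (preserving \<omega>)"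

definition hamiltonian :: "'w \<Rightarrow> 'a \<Rightarrow> bool" where
  "hamiltonian \<omega> a \<longleftrightarrow> d (\<iota> a) \<in> tilde \<omega> ` preserving \<omega>"

definition ham_field :: "'w \<Rightarrow> 'a \<Rightarrow> 'a \<Rightarrow> 'a" where
  "ham_field \<omega> a = (THE \<theta>. \<theta> \<in> preserving \<omega> \<and> tilde \<omega> \<theta> = d (\<iota> a))"

definition poisson :: "'w \<Rightarrow> 'a \<Rightarrow> 'a \<Rightarrow> 'a" where
  "poisson \<omega> a b = ham_field \<omega> a b"

lemma ham_field_works:
  assumes "nonsingular \<omega>" and "hamiltonian \<omega> a"
  shows "ham_field \<omega> a \<in> preserving \<omega>" and "tilde \<omega> (ham_field \<omega> a) = d (\<iota> a)"
proof -
  have "\<exists>!\<theta>. \<theta> \<in> preserving \<omega> \<and> tilde \<omega> \<theta> = d (\<iota> a)"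
    using assms unfolding nonsingular_def hamiltonian_def by (auto simp: inj_on_def)
  from theI'[OF this] show "ham_field \<omega> a \<in> preserving \<omega>" "tilde \<omega> (ham_field \<omega> a) = d (\<iota> a)"
    unfolding ham_field_def by blast+
qed

lemma poisson_eq_interior:
  assumes "nonsingular \<omega>" and "hamiltonian \<omega> a"
  shows "\<iota> (poisson \<omega> a b) = interior (ham_field \<omega> a) (d (\<iota> b))"
  using ham_field_works(1)[OF assms] interior_works
  unfolding poisson_def preserving_def is_interior_product_def by simp

end

end

theory Submission imports Defs begin

text \<open>
  Interior products along two derivations anticommute: in the expansion of both compositions on
  \<open>u db\<close>, the mixed terms agree up to sign. Hence
  \<open>{a, b} = X\<^sub>a \<lrcorner> db = X\<^sub>a \<lrcorner> (X\<^sub>b \<lrcorner> \<omega>)\<close> is antisymmetric.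
\<close>

context differential_calculus
begin

lemma interior_product_anticommute:
  assumes i: "is_interior_product \<theta> i" and j: "is_interior_product \<phi> j"
  shows "i (j w) = - j (i w)"
proof -
  have lin: "Vector_Spaces.linear scaleW scaleW i" "Vector_Spaces.linear scaleW scaleW j"
    using i j by (auto simp: is_interior_product_def)
  interpret i: Vector_Spaces.linear scaleW scaleW i by (rule lin)
  interpret j: Vector_Spaces.linear scaleW scaleW j by (rule lin)
  have "(\<lambda>w. i (j w)) = (\<lambda>w. - j (i w))"
  \<comment> \<open>Forms are spanned by functions and by products \<open>u * d (\<iota> b)\<close>,
    so two linear maps agree once they agree on functions and agreement passes from \<open>u\<close>
    to \<open>u * d (\<iota> b)\<close>.\<close>
  proof (rule linear_eqI)
    show "Vector_Spaces.linear scaleW scaleW (\<lambda>w. i (j w))"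
      by unfold_locales (simp_all add: i.add j.add i.scale j.scale)
    show "Vector_Spaces.linear scaleW scaleW (\<lambda>w. - j (i w))"
      by unfold_locales (simp_all add: i.add j.add i.scale j.scale)
    show "i (j (\<iota> a)) = - j (i (\<iota> a))" for a
      using i j by (simp add: is_interior_product_def)
    fix n u b
    assume u: "u \<in> \<Omega> n" and IH: "i (j u) = - j (i u)"
    \<comment> \<open>Stated for a generic pair so that it serves both orders of composition:
      exchanging \<open>k\<close>, \<open>\<chi>\<close> with \<open>l\<close>,
      \<open>\<psi>\<close> flips the sign of the scaled difference.\<close>
    have expand: "k (l (u * d (\<iota> b))) = k (l u) * d (\<iota> b)
        + scaleW ((-1) ^ n) (k u * \<iota> (\<psi> b) - l u * \<iota> (\<chi> b))"
      if k: "is_interior_product \<chi> k" and l: "is_interior_product \<psi> l" for k l \<chi> \<psi>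
    proof -
      interpret k: Vector_Spaces.linear scaleW scaleW k
        using k by (simp add: is_interior_product_def)
      have l_u: "l (u * d (\<iota> b)) = l u * d (\<iota> b) + scaleW ((-1) ^ n) (u * \<iota> (\<psi> b))"
        using l u d_\<iota>_form[of b] by (simp add: is_interior_product_def)
      \<comment> \<open>The second term of the Leibniz rule vanishes, since \<open>k\<close> kills
        functions.\<close>
      have k_u: "k (u * \<iota> (\<psi> b)) = k u * \<iota> (\<psi> b)"
      proof -
        have "\<iota> (\<psi> b) \<in> \<Omega> 0"
          using range_\<iota> by blast
        with k u show ?thesis
          by (simp add: is_interior_product_def)
      qed
      have k_l: "k (l u * d (\<iota> b)) = k (l u) * d (\<iota> b) - scaleW ((-1) ^ n) (l u * \<iota> (\<chi> b))"
      \<comment> \<open>The minus sign arises because \<open>l u\<close> has degree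
        \<open>n - 1\<close>. For \<open>n = 0\<close> there is no such degree, but then
        \<open>u\<close> is a function, \<open>l u = 0\<close>, and both sides vanish.\<close>
      proof (cases n)
        case 0
        then obtain a where "u = \<iota> a"
          using u range_\<iota> by blast
        with l show ?thesis
          by (simp add: is_interior_product_def)
      next
        case (Suc m)
        then have "l u \<in> \<Omega> m"
          using l u by (auto simp: is_interior_product_def)
        with k d_\<iota>_form[of b] Suc show ?thesis
          by (simp add: is_interior_product_def)
      qed
      show ?thesis
        by (simp add: l_u k.add k.scale k_u k_l W.scale_right_diff_distrib)
    qed
    show "i (j (u * d (\<iota> b))) = - j (i (u * d (\<iota> b)))"
      by (simp add: expand[OF i j] expand[OF j i] IH W.scale_right_diff_distrib)
  qed
  then show ?thesis
    by (rule fun_cong)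
qed

end

context calculus_with_derivations
begin

text \<open>The defining equation of the Hamiltonian field of \<open>b\<close> replaces
  \<open>d (\<iota> b)\<close> by a contraction of \<open>\<omega>\<close>, so exchanging
  \<open>a\<close> and \<open>b\<close> only swaps the order of two contractions.\<close>

lemma poisson_eq_interior_interior:
  assumes "nonsingular \<omega>" "hamiltonian \<omega> a" "hamiltonian \<omega> b"
  shows "\<iota> (poisson \<omega> a b) = interior (ham_field \<omega> a) (interior (ham_field \<omega> b) \<omega>)"
  using poisson_eq_interior[OF assms(1,2)] ham_field_works(2)[OF assms(1,3)]
  by (simp add: tilde_def)

lemma poisson_antisym:
  assumes "nonsingular \<omega>" "hamiltonian \<omega> a" "hamiltonian \<omega> b"
  shows "poisson \<omega> a b = - poisson \<omega> b a"
proof -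
  interpret \<iota>: Vector_Spaces.linear scaleA scaleW \<iota> by (rule linear_\<iota>)
  have "ham_field \<omega> a \<in> V" "ham_field \<omega> b \<in> V"
    using ham_field_works(1)[OF assms(1)] assms by (auto simp: preserving_def)
  then have "interior (ham_field \<omega> a) (interior (ham_field \<omega> b) \<omega>) =
      - interior (ham_field \<omega> b) (interior (ham_field \<omega> a) \<omega>)"
    by (rule interior_product_anticommute[OF interior_works interior_works])
  \<comment> \<open>Contractions live in the algebra of forms, so the identity is first obtained
    under \<open>\<iota>\<close>; injectivity then brings it back to functions.\<close>
  then have "\<iota> (poisson \<omega> a b) = \<iota> (- poisson \<omega> b a)"
    using assms by (simp only: poisson_eq_interior_interior \<iota>.neg)
  then show ?thesis
    using inj_\<iota> by (simp add: inj_eq)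
qed

end

theorem proposition3p2:
  fixes scaleA :: "'k::field \<Rightarrow> 'a::{ring, monoid_mult} \<Rightarrow> 'a"
    and scaleW :: "'k \<Rightarrow> 'w::{ring, monoid_mult} \<Rightarrow> 'w"
    and \<iota> :: "'a \<Rightarrow> 'w"
    and \<Omega> :: "nat \<Rightarrow> 'w set"
    and d :: "'w \<Rightarrow> 'w"
    and V :: "('a \<Rightarrow> 'a) set"
    and \<omega> :: 'w
    and a b :: 'a
  assumes "calculus_with_derivations scaleA scaleW \<iota> \<Omega> d V"
    and "\<omega> \<in> \<Omega> 2"
    and "d \<omega> = 0"
    and "calculus_with_derivations.nonsingular scaleW \<iota> \<Omega> d V \<omega>"
    and "calculus_with_derivations.hamiltonian scaleW \<iota> \<Omega> d V \<omega> a"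
    and "calculus_with_derivations.hamiltonian scaleW \<iota> \<Omega> d V \<omega> b"
  shows "calculus_with_derivations.poisson scaleW \<iota> \<Omega> d V \<omega> a b
       = - calculus_with_derivations.poisson scaleW \<iota> \<Omega> d V \<omega> b a"
  using assms(1,4,5,6) by (rule calculus_with_derivations.poisson_antisym)

end
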